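(* Let $(X,*,0)$ be a bounded commutative BCK-algebra with greatest element $1$, and let $(X,\oplus,',0)$ be the associated MV-algebra. If $\mu$ is a left state operator on the BCK-algebra $X$ such that $\mu(1)=1$, then $(X,\mu)$ is a state MV-algebra. Conversely, if $\mu:X\to X$ is a map such that $(X,\mu)$ is a state MV-algebra, then $\mu$ is a left state operator on the BCK-algebra $(X,*,0)$ with $\mu(1)=1$.
   Context: A BCK-algebra is an algebra $(X,*,0)$ of type $(2,0)$ such that for all $x,y,z\in X$: $((x*y)*(x*z))*(z*y)=0$; $x*0=x$; $x*y=0$ and $y*x=0$ imply $x=y$; $0*x=0$. It is partially ordered by $x\le y\iff x*y=0$. It is bounded if it has a greatest element $1$ (and then $Nx:=1*x$), and commutative if $x*(x*y)=y*(y*x)$ for all $x,y$. A left state operator on $X$ is a map $\mu:X\to X$ such that for all $x,y\in X$: (S0) $x*y=0$ implies $\mu(x)*\mu(y)=0$; (S1) $\mu(x*y)=\mu(x)*\mu(x*(x*y))$; (S2) $\mu(\mu(x)*\mu(y))=\mu(x)*\mu(y)$. An MV-algebra is an algebra $(M,\oplus,',0)$ of type $(2,1,0)$ where $(M,\oplus,0)$ is a commutative monoid with neutral element $0$, $x''=x$, $x\oplus 1=1$ with $1=0'$, and $x\oplus(x\oplus y')'=y\oplus(y\oplus x')'$. Put $x\odot y=(x'\oplus y')'$ and $x\ominus y=(x'\oplus y)'$. If $X$ is a bounded commutative BCK-algebra, the associated MV-algebra $(X,\oplus,',0)$ is given by $x\oplus y=N(Nx*y)$ and $x'=Nx$; then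 $x*y=x\odot y'$. A state MV-algebra is a pair $(M,\sigma)$ where $M$ is an MV-algebra and $\sigma:M\to M$ satisfies, for all $x,y$: $\sigma(1)=1$; $\sigma(x')=\sigma(x)'$; $\sigma(x\oplus y)=\sigma(x)\oplus\sigma(y\ominus(x\odot y))$; $\sigma(\sigma(x)\oplus\sigma(y))=\sigma(x)\oplus\sigma(y)$. *)

theory Defs
  imports "HOL-Library.FuncSet"
begin

text \<open>
  Algebras are given by an explicit carrier set together with operations on the ambient type,
  all axioms being relativised to the carrier.
\<close>

locale bck_algebra =
  fixes X :: "'a set"
    and diff :: "'a \<Rightarrow> 'a \<Rightarrow> 'a" (infixl "\<star>" 70)
    and zero :: 'a ("\<zero>")
  assumes diff_closed: "\<lbrakk>x \<in> X; y \<in> X\<rbrakk> \<Longrightarrow> x \<star> y \<in> X"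
    and zero_closed: "\<zero> \<in> X"
    and diff_diff: "\<lbrakk>x \<in> X; y \<in> X; z \<in> X\<rbrakk> \<Longrightarrow> ((x \<star> y) \<star> (x \<star> z)) \<star> (z \<star> y) = \<zero>"
    and diff_zero: "x \<in> X \<Longrightarrow> x \<star> \<zero> = x"
    and diff_antisym: "\<lbrakk>x \<in> X; y \<in> X; x \<star> y = \<zero>; y \<star> x = \<zero>\<rbrakk> \<Longrightarrow> x = y"
    and zero_diff: "x \<in> X \<Longrightarrow> \<zero> \<star> x = \<zero>"
begin

definition le :: "'a \<Rightarrow> 'a \<Rightarrow> bool" (infix "\<sqsubseteq>" 50)
  where "x \<sqsubseteq> y \<longleftrightarrow> x \<star> y = \<zero>"

end

locale bounded_bck_algebra = bck_algebra +
  fixes one :: 'a ("\<one>")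
  assumes one_closed: "\<one> \<in> X"
    and one_greatest: "x \<in> X \<Longrightarrow> x \<sqsubseteq> \<one>"

locale commutative_bck_algebra = bck_algebra +
  assumes diff_comm: "\<lbrakk>x \<in> X; y \<in> X\<rbrakk> \<Longrightarrow> x \<star> (x \<star> y) = y \<star> (y \<star> x)"

locale bounded_commutative_bck_algebra = bounded_bck_algebra + commutative_bck_algebra

definition bck_neg :: "('a \<Rightarrow> 'a \<Rightarrow> 'a) \<Rightarrow> 'a \<Rightarrow> 'a \<Rightarrow> 'a"
  where "bck_neg diff one x = diff one x"

definition bck_oplus :: "('a \<Rightarrow> 'a \<Rightarrow> 'a) \<Rightarrow> 'a \<Rightarrow> 'a \<Rightarrow> 'a \<Rightarrow> 'a"
  where "bck_oplus diff one x y = bck_neg diff one (diff (bck_neg diff one x) y)"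

locale left_state_operator = bck_algebra +
  fixes \<mu> :: "'a \<Rightarrow> 'a"
  assumes maps_to: "\<mu> \<in> X \<rightarrow> X"
    and S0: "\<lbrakk>x \<in> X; y \<in> X; x \<star> y = \<zero>\<rbrakk> \<Longrightarrow> \<mu> x \<star> \<mu> y = \<zero>"
    and S1: "\<lbrakk>x \<in> X; y \<in> X\<rbrakk> \<Longrightarrow> \<mu> (x \<star> y) = \<mu> x \<star> \<mu> (x \<star> (x \<star> y))"
    and S2: "\<lbrakk>x \<in> X; y \<in> X\<rbrakk> \<Longrightarrow> \<mu> (\<mu> x \<star> \<mu> y) = \<mu> x \<star> \<mu> y"

locale mv_algebra =
  fixes M :: "'a set"
    and oplus :: "'a \<Rightarrow> 'a \<Rightarrow> 'a" (infixl "\<oplus>" 65)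
    and neg :: "'a \<Rightarrow> 'a"
    and zero :: 'a ("\<zero>")
  assumes oplus_closed: "\<lbrakk>x \<in> M; y \<in> M\<rbrakk> \<Longrightarrow> x \<oplus> y \<in> M"
    and neg_closed: "x \<in> M \<Longrightarrow> neg x \<in> M"
    and zero_closed: "\<zero> \<in> M"
    and oplus_assoc: "\<lbrakk>x \<in> M; y \<in> M; z \<in> M\<rbrakk> \<Longrightarrow> (x \<oplus> y) \<oplus> z = x \<oplus> (y \<oplus> z)"
    and oplus_comm: "\<lbrakk>x \<in> M; y \<in> M\<rbrakk> \<Longrightarrow> x \<oplus> y = y \<oplus> x"
    and oplus_zero: "x \<in> M \<Longrightarrow> x \<oplus> \<zero> = x"
    and neg_neg: "x \<in> M \<Longrightarrow> neg (neg x) = x"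
    and oplus_one: "x \<in> M \<Longrightarrow> x \<oplus> neg \<zero> = neg \<zero>"
    and lukasiewicz: "\<lbrakk>x \<in> M; y \<in> M\<rbrakk> \<Longrightarrow> x \<oplus> neg (x \<oplus> neg y) = y \<oplus> neg (y \<oplus> neg x)"
begin

definition mv_one :: 'a ("\<one>")
  where "\<one> = neg \<zero>"

definition odot :: "'a \<Rightarrow> 'a \<Rightarrow> 'a" (infixl "\<odot>" 70)
  where "x \<odot> y = neg (neg x \<oplus> neg y)"

definition ominus :: "'a \<Rightarrow> 'a \<Rightarrow> 'a" (infixl "\<ominus>" 65)
  where "x \<ominus> y = neg (neg x \<oplus> y)"

end

locale state_mv_algebra = mv_algebra +
  fixes \<sigma> :: "'a \<Rightarrow> 'a"
  assumes maps_to: "\<sigma> \<in> M \<rightarrow> M"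
    and state_one: "\<sigma> \<one> = \<one>"
    and state_neg: "x \<in> M \<Longrightarrow> \<sigma> (neg x) = neg (\<sigma> x)"
    and state_oplus: "\<lbrakk>x \<in> M; y \<in> M\<rbrakk> \<Longrightarrow> \<sigma> (x \<oplus> y) = \<sigma> x \<oplus> \<sigma> (y \<ominus> (x \<odot> y))"
    and state_idem: "\<lbrakk>x \<in> M; y \<in> M\<rbrakk> \<Longrightarrow> \<sigma> (\<sigma> x \<oplus> \<sigma> y) = \<sigma> x \<oplus> \<sigma> y"

end

theory Submission
  imports Defs
begin

text \<open>
  In a bounded commutative BCK-algebra the negation \<open>N x = \<one> \<star> x\<close> is an involution which turns
  \<open>x \<star> y\<close> around into \<open>N y \<star> N x\<close>, and \<open>\<star>\<close> and \<open>\<oplus>\<close> are interdefinable: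
  \<open>x \<oplus> y = N (N x \<star> y)\<close> and \<open>x \<star> y = N (N x \<oplus> y)\<close>. The expression \<open>y \<ominus> (x \<odot> y)\<close> in the
  additivity law of a state MV-algebra is \<open>N x \<star> (N x \<star> y)\<close>, the meet of \<open>N x\<close> and \<open>y\<close>
  (\<open>ominus_odot\<close>). Hence, for a map that commutes with \<open>N\<close>, additivity at \<open>(x, y)\<close> is the negation
  of (S1) at \<open>(N x, y)\<close>, and idempotency at \<open>(x, y)\<close> is the negation of (S2) at \<open>(N x, y)\<close>; as
  \<open>N\<close> is a bijection, each pair of laws is equivalent.

  Two points remain. Commutation with \<open>N\<close> is an axiom for states, while for a left state operator
  it is (S1) at \<open>(\<one>, x)\<close> together with \<open>\<mu> \<one> = \<one>\<close>. Monotonicity (S0) is an axiom for left state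
  operators, while for states it follows from (S1): if \<open>x \<sqsubseteq> y\<close> then \<open>x = y \<star> (y \<star> x)\<close> by
  commutativity, so (S1) exhibits \<open>\<mu> x\<close> as a difference \<open>\<mu> y \<star> z\<close>, and such differences lie
  below \<open>\<mu> y\<close>.
\<close>

section \<open>Arithmetic of BCK-algebras\<close>

context bck_algebra
begin

lemma diff_self: "x \<in> X \<Longrightarrow> x \<star> x = \<zero>"
  using diff_diff[of x \<zero> \<zero>] by (simp add: diff_zero diff_closed zero_closed)

lemma diff_diff_le: "\<lbrakk>x \<in> X; z \<in> X\<rbrakk> \<Longrightarrow> (x \<star> (x \<star> z)) \<star> z = \<zero>"
  using diff_diff[of x \<zero> z] by (simp add: diff_zero diff_closed zero_closed)

lemma le_trans:
  assumes "x \<in> X" "y \<in> X" "z \<in> X" "x \<star> y = \<zero>" "y \<star> z = \<zero>"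
  shows "x \<star> z = \<zero>"
  using diff_diff[of x z y] assms by (simp add: diff_zero diff_closed)

lemma diff_antimono:
  assumes "x \<in> X" "y \<in> X" "z \<in> X" "z \<star> y = \<zero>"
  shows "(x \<star> y) \<star> (x \<star> z) = \<zero>"
  using diff_diff[of x y z] assms by (simp add: diff_zero diff_closed)

text \<open>
  One inequality suffices by symmetry. Since \<open>x \<star> (x \<star> z) \<sqsubseteq> z\<close>, subtracting \<open>z\<close> from \<open>x \<star> y\<close>
  leaves at most \<open>(x \<star> y) \<star> (x \<star> (x \<star> z))\<close>, which the first BCK axiom bounds by
  \<open>(x \<star> z) \<star> y\<close>.
\<close>

lemma diff_right_commute:
  assumes "x \<in> X" "y \<in> X" "z \<in> X"
  shows "(x \<star> y) \<star> z = (x \<star> z) \<star> y"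
proof -
  have half: "((x \<star> y) \<star> z) \<star> ((x \<star> z) \<star> y) = \<zero>" if "x \<in> X" "y \<in> X" "z \<in> X" for x y z
  proof (rule le_trans)
    show "((x \<star> y) \<star> z) \<star> ((x \<star> y) \<star> (x \<star> (x \<star> z))) = \<zero>"
      using that by (simp add: diff_antimono diff_diff_le diff_closed)
    show "((x \<star> y) \<star> (x \<star> (x \<star> z))) \<star> ((x \<star> z) \<star> y) = \<zero>"
      using that by (simp add: diff_diff diff_closed)
  qed (use that in \<open>simp_all add: diff_closed\<close>)
  show ?thesis
    by (rule diff_antisym) (simp_all add: assms half diff_closed)
qed

lemma diff_le_left:
  assumes "x \<in> X" "y \<in> X"
  shows "(x \<star> y) \<star> x = \<zero>"
  using assms diff_right_commute[of x y x] by (simp add: diff_self zero_diff)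

end

section \<open>The associated MV-algebra\<close>

context bounded_commutative_bck_algebra
begin

abbreviation N :: "'a \<Rightarrow> 'a"
  where "N \<equiv> bck_neg (\<star>) \<one>"

abbreviation plus :: "'a \<Rightarrow> 'a \<Rightarrow> 'a" (infixl "\<oplus>" 65)
  where "(\<oplus>) \<equiv> bck_oplus (\<star>) \<one>"

lemma neg_closed: "x \<in> X \<Longrightarrow> N x \<in> X"
  by (simp add: bck_neg_def diff_closed one_closed)

lemma neg_zero: "N \<zero> = \<one>"
  by (simp add: bck_neg_def diff_zero one_closed)

lemma diff_one: "x \<in> X \<Longrightarrow> x \<star> \<one> = \<zero>"
  using one_greatest by (simp add: le_def)

lemma neg_neg: "x \<in> X \<Longrightarrow> N (N x) = x"
  using diff_comm[of \<one> x] by (simp add: bck_neg_def diff_one diff_zero one_closed)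

lemma neg_diff_neg:
  assumes "x \<in> X" "y \<in> X"
  shows "N y \<star> N x = x \<star> y"
proof -
  have "N y \<star> N x = N (N x) \<star> y"
    using assms diff_right_commute[of \<one> y "N x"] by (simp add: bck_neg_def diff_closed one_closed)
  then show ?thesis
    using assms by (simp add: neg_neg)
qed

lemma neg_diff_comm:
  assumes "x \<in> X" "y \<in> X"
  shows "N x \<star> y = N y \<star> x"
  using neg_diff_neg[of "N x" y] assms by (simp add: neg_neg neg_closed)

lemma oplus_eq: "x \<oplus> y = N (N x \<star> y)"
  by (simp add: bck_oplus_def)

lemma oplus_closed: "\<lbrakk>x \<in> X; y \<in> X\<rbrakk> \<Longrightarrow> x \<oplus> y \<in> X"
  by (simp add: oplus_eq neg_closed diff_closed)

lemma neg_oplus: "\<lbrakk>x \<in> X; y \<in> X\<rbrakk> \<Longrightarrow> N (x \<oplus> y) = N x \<star> y"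
  by (simp add: oplus_eq neg_neg neg_closed diff_closed)

lemma diff_eq: "\<lbrakk>x \<in> X; y \<in> X\<rbrakk> \<Longrightarrow> x \<star> y = N (N x \<oplus> y)"
  by (simp add: neg_oplus neg_neg neg_closed)

lemma oplus_comm: "\<lbrakk>x \<in> X; y \<in> X\<rbrakk> \<Longrightarrow> x \<oplus> y = y \<oplus> x"
  by (simp add: oplus_eq neg_diff_comm)

text \<open>
  Both sides are the negation of the double difference \<open>N y \<star> x \<star> z\<close>, in which the order of
  subtraction is immaterial.
\<close>

lemma oplus_assoc:
  assumes "x \<in> X" "y \<in> X" "z \<in> X"
  shows "(x \<oplus> y) \<oplus> z = x \<oplus> (y \<oplus> z)"
proof -
  have "(x \<oplus> y) \<oplus> z = N ((N y \<star> x) \<star> z)"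
    using assms by (simp add: oplus_eq[of "x \<oplus> y"] neg_oplus neg_diff_comm)
  also have "\<dots> = N ((N y \<star> z) \<star> x)"
    using assms by (simp add: diff_right_commute neg_closed)
  also have "\<dots> = (y \<oplus> z) \<oplus> x"
    using assms by (simp add: oplus_eq[of "y \<oplus> z"] neg_oplus)
  also have "\<dots> = x \<oplus> (y \<oplus> z)"
    using assms by (simp add: oplus_comm oplus_closed)
  finally show ?thesis .
qed

text \<open>
  The Lukasiewicz axiom is commutativity of the meet at \<open>N x\<close> and \<open>N y\<close>, negated.
\<close>

lemma associated_mv_algebra: "mv_algebra X (\<oplus>) N \<zero>"
proof
  fix x y assume xy: "x \<in> X" "y \<in> X"
  have join: "x \<oplus> N (x \<oplus> N y) = N (N x \<star> (N x \<star> N y))" if "x \<in> X" "y \<in> X" for x y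
    using that by (simp add: neg_oplus neg_closed oplus_eq[of x "N x \<star> N y"])
  show "x \<oplus> N (x \<oplus> N y) = y \<oplus> N (y \<oplus> N x)"
    using xy join diff_comm[of "N x" "N y"] by (simp add: neg_closed)
  show "(x \<oplus> y) \<oplus> z = x \<oplus> (y \<oplus> z)" if "z \<in> X" for z
    using xy that by (rule oplus_assoc)
qed (simp_all add: oplus_closed neg_closed zero_closed oplus_comm neg_neg
       neg_zero oplus_eq[of _ \<zero>] oplus_eq[of _ \<one>] diff_zero diff_one)

interpretation mv: mv_algebra X "(\<oplus>)" N \<zero>
  by (rule associated_mv_algebra)

lemma mv_one_eq: "mv.mv_one = \<one>"
  by (simp add: mv.mv_one_def neg_zero)

lemma ominus_odot:
  assumes "x \<in> X" "y \<in> X"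
  shows "mv.ominus y (mv.odot x y) = N x \<star> (N x \<star> y)"
proof -
  have "mv.odot x y = y \<star> N x"
    using assms neg_diff_neg[of x "N y"]
    by (simp add: mv.odot_def neg_oplus neg_neg neg_closed neg_diff_neg)
  then have "mv.ominus y (mv.odot x y) = y \<star> (y \<star> N x)"
    using assms by (simp add: mv.ominus_def diff_eq[symmetric] diff_closed neg_closed)
  then show ?thesis
    using assms diff_comm[of y "N x"] by (simp add: neg_closed)
qed

section \<open>States and left state operators\<close>

lemma left_state_operator_imp_state:
  assumes "left_state_operator X (\<star>) \<zero> \<mu>" and one: "\<mu> \<one> = \<one>"
  shows "state_mv_algebra X (\<oplus>) N \<zero> \<mu>"
proof -
  interpret L: left_state_operator X "(\<star>)" \<zero> \<mu> by fact
  have \<mu>_closed: "\<mu> x \<in> X" if "x \<in> X" for x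
    using that L.maps_to by blast
  have \<mu>_neg: "\<mu> (N x) = N (\<mu> x)" if "x \<in> X" for x
    using that L.S1[of \<one> x] neg_neg[of x] by (simp add: bck_neg_def one one_closed)
  show ?thesis
  proof
    fix x y assume xy: "x \<in> X" "y \<in> X"
    let ?m = "N x \<star> (N x \<star> y)"
    have "\<mu> (x \<oplus> y) = N (\<mu> (N x \<star> y))"
      using xy by (simp add: oplus_eq \<mu>_neg diff_closed neg_closed)
    also have "\<mu> (N x \<star> y) = N (\<mu> x) \<star> \<mu> ?m"
      using xy L.S1[of "N x" y] by (simp add: \<mu>_neg neg_closed)
    finally show "\<mu> (x \<oplus> y) = \<mu> x \<oplus> \<mu> (mv.ominus y (mv.odot x y))"
      using xy by (simp add: ominus_odot oplus_eq)
    have "\<mu> (\<mu> x \<oplus> \<mu> y) = N (\<mu> (\<mu> (N x) \<star> \<mu> y))"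
      using xy by (simp add: oplus_eq \<mu>_neg diff_closed neg_closed \<mu>_closed)
    also have "\<mu> (\<mu> (N x) \<star> \<mu> y) = \<mu> (N x) \<star> \<mu> y"
      using xy by (simp add: L.S2 neg_closed)
    finally show "\<mu> (\<mu> x \<oplus> \<mu> y) = \<mu> x \<oplus> \<mu> y"
      using xy by (simp add: oplus_eq \<mu>_neg)
  qed (simp_all add: L.maps_to mv_one_eq one \<mu>_neg)
qed

lemma state_imp_left_state_operator:
  assumes "state_mv_algebra X (\<oplus>) N \<zero> \<mu>"
  shows "left_state_operator X (\<star>) \<zero> \<mu>"
proof -
  interpret S: state_mv_algebra X "(\<oplus>)" N \<zero> \<mu> by fact
  have \<mu>_closed: "\<mu> x \<in> X" if "x \<in> X" for x
    using that S.maps_to by blast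
  have S1: "\<mu> (x \<star> y) = \<mu> x \<star> \<mu> (x \<star> (x \<star> y))" if xy: "x \<in> X" "y \<in> X" for x y
  proof -
    have "\<mu> (x \<star> y) = N (\<mu> (N x \<oplus> y))"
      using xy by (simp add: diff_eq S.state_neg oplus_closed neg_closed)
    also have "\<mu> (N x \<oplus> y) = N (\<mu> x) \<oplus> \<mu> (x \<star> (x \<star> y))"
      using xy by (simp add: S.state_oplus S.state_neg ominus_odot neg_neg neg_closed)
    finally show ?thesis
      using xy by (simp add: diff_eq[symmetric] diff_closed \<mu>_closed)
  qed
  show ?thesis
  proof
    show "\<mu> \<in> X \<rightarrow> X" by (rule S.maps_to)
    fix x y assume xy: "x \<in> X" "y \<in> X"
    show "\<mu> (x \<star> y) = \<mu> x \<star> \<mu> (x \<star> (x \<star> y))"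
      using xy by (rule S1)
    show "\<mu> x \<star> \<mu> y = \<zero>" if "x \<star> y = \<zero>"
    proof -
      have "x = y \<star> (y \<star> x)"
        using xy that diff_comm[of x y] by (simp add: diff_zero)
      then have "\<mu> x = \<mu> y \<star> \<mu> (y \<star> x)"
        using xy S1[of y "y \<star> x"] by (simp add: diff_closed)
      then show ?thesis
        using xy by (simp add: diff_le_left \<mu>_closed diff_closed)
    qed
    have "\<mu> (\<mu> x \<star> \<mu> y) = N (\<mu> (\<mu> (N x) \<oplus> \<mu> y))"
      using xy by (simp add: diff_eq S.state_neg oplus_closed neg_closed \<mu>_closed)
    also have "\<mu> (\<mu> (N x) \<oplus> \<mu> y) = \<mu> (N x) \<oplus> \<mu> y"
      using xy by (simp add: S.state_idem neg_closed)
    finally show "\<mu> (\<mu> x \<star> \<mu> y) = \<mu> x \<star> \<mu> y"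
      using xy by (simp add: S.state_neg diff_eq[symmetric] \<mu>_closed)
  qed
qed

lemma state_one_eq:
  assumes "state_mv_algebra X (\<oplus>) N \<zero> \<mu>"
  shows "\<mu> \<one> = \<one>"
  using state_mv_algebra.state_one[OF assms] by (simp add: mv_one_eq)

end

theorem theorem3p16:
  fixes X :: "'a set"
    and diff :: "'a \<Rightarrow> 'a \<Rightarrow> 'a"
    and zero one :: 'a
    and \<mu> :: "'a \<Rightarrow> 'a"
  assumes "bounded_commutative_bck_algebra X diff zero one"
  shows "(left_state_operator X diff zero \<mu> \<and> \<mu> one = one \<longrightarrow>
            state_mv_algebra X (bck_oplus diff one) (bck_neg diff one) zero \<mu>) \<and>
         (state_mv_algebra X (bck_oplus diff one) (bck_neg diff one) zero \<mu> \<longrightarrow>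
            left_state_operator X diff zero \<mu> \<and> \<mu> one = one)"
proof -
  interpret bounded_commutative_bck_algebra X diff zero one by fact
  show ?thesis
    using left_state_operator_imp_state state_imp_left_state_operator state_one_eq by blast
qed

end
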